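(* For every $\epsilon\in(0,1)$, every nonadaptive algorithm that, on a real-valued array $A$ of length $n$, outputs an additive $\epsilon n$-approximation to the length of the longest increasing subsequence (LIS) of $A$ has to make $\log^{\Omega(\log(1/\epsilon))} n$ queries.
   Context: A real-valued array $A$ of length $n$ is accessed through an oracle which, on query $i\in[n]=\{1,\dots,n\}$, returns $A[i]$. An algorithm (possibly randomized, required to give a correct answer with probability at least $2/3$) is nonadaptive if its queries do not depend on the answers to its previous queries. A longest increasing subsequence (LIS) of $A$ is a largest-cardinality set $\mathcal{L}\subseteq[n]$ of indices such that $A[u]\le A[v]$ for all $u<v$ in $\mathcal{L}$ (i.e. nondecreasing subsequences are allowed); its length is $|\mathcal{L}|$. An additive $\epsilon n$-approximation to the LIS length is a number $\mathsf{est}$ with $\big|\mathsf{est}-|\mathcal{L}|\big|\le\epsilon n$. Here $\epsilon$ is regarded as a constant and the bound is asymptotic in $n$; the $\Omega(\cdot)$ in the exponent hides an absolute constant.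
   Formalization: The theorem is proved for ε in (0,1/2) instead of (0,1): for every ε ≥ 1/2 the claim is false, since always answering n/2 makes no queries and has error at most n/2 ≤ εn. *)

theory Defs
  imports "HOL-Probability.Probability"
begin

text \<open>An array of length \<open>n\<close> is a function \<open>A :: nat \<Rightarrow> real\<close> of which only the values on
  \<open>{1..n}\<close> matter. "Increasing" means nondecreasing, as in the source.\<close>

definition increasing_indices :: "nat \<Rightarrow> (nat \<Rightarrow> real) \<Rightarrow> nat set \<Rightarrow> bool" where
  "increasing_indices n A L \<longleftrightarrow>
     L \<subseteq> {1..n} \<and> (\<forall>u\<in>L. \<forall>v\<in>L. u < v \<longrightarrow> A u \<le> A v)"

definition lis_length :: "nat \<Rightarrow> (nat \<Rightarrow> real) \<Rightarrow> nat" where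
  "lis_length n A = Max {card L | L. increasing_indices n A L}"

text \<open>A deterministic nonadaptive algorithm is a list of queries, fixed in advance, together with
  an arbitrary function that turns the list of answers into the estimate.\<close>

type_synonym det_nonadaptive = "nat list \<times> (real list \<Rightarrow> real)"

definition queries :: "det_nonadaptive \<Rightarrow> nat list" where
  "queries a = fst a"

definition estimate :: "det_nonadaptive \<Rightarrow> (nat \<Rightarrow> real) \<Rightarrow> real" where
  "estimate a A = snd a (map A (queries a))"

text \<open>A randomized nonadaptive algorithm is a probability measure on deterministic ones. Its
  \<open>\<sigma>\<close>-algebra is arbitrary, so an algorithm driven by a random seed from any probability space is
  covered, by pushing the measure forward. The number of queries is bounded in the worst case over
  the randomness.\<close>

definition nonadaptive_alg :: "nat \<Rightarrow> nat \<Rightarrow> det_nonadaptive measure \<Rightarrow> bool" where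
  "nonadaptive_alg n q M \<longleftrightarrow>
     prob_space M \<and>
     (\<forall>a\<in>space M. set (queries a) \<subseteq> {1..n} \<and> length (queries a) \<le> q)"

text \<open>The bound \<open>2/3\<close> forces the event to be measurable, because \<open>measure\<close> is \<open>0\<close> on
  nonmeasurable sets.\<close>

definition approximates_lis_length :: "real \<Rightarrow> nat \<Rightarrow> det_nonadaptive measure \<Rightarrow> bool" where
  "approximates_lis_length \<epsilon> n M \<longleftrightarrow>
     (\<forall>A :: nat \<Rightarrow> real.
        measure M {a \<in> space M. \<bar>estimate a A - real (lis_length n A)\<bar> \<le> \<epsilon> * real n} \<ge> 2 / 3)"

lemma lis_length_le: "lis_length n A \<le> n"
proof -
  let ?S = "{card L | L. increasing_indices n A L}"
  have le: "k \<le> n" if "k \<in> ?S" for k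
    using that card_mono[of "{1..n}"] by (fastforce simp: increasing_indices_def)
  then have "finite ?S"
    by (meson finite_nat_set_iff_bounded_le)
  moreover have "increasing_indices n A {}"
    by (simp add: increasing_indices_def)
  then have "?S \<noteq> {}"
    by blast
  ultimately show ?thesis
    unfolding lis_length_def using le Max_in by blast
qed

text \<open>For \<open>\<epsilon> \<ge> 1/2\<close> the constant answer \<open>n/2\<close> is always correct, so no positive lower bound on the
  number of queries holds there. Query lower bounds are therefore stated for
  \<open>0 < \<epsilon> < 1/2\<close>.\<close>

lemma no_queries_needed:
  fixes \<epsilon> :: real
  assumes "\<epsilon> \<ge> 1 / 2"
  shows "\<exists>M. nonadaptive_alg n 0 M \<and> approximates_lis_length \<epsilon> n M"
proof -
  define a where "a = ([] :: nat list, \<lambda>_ :: real list. real n / 2)"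
  define M where "M = return (count_space {a}) a"
  have ps: "prob_space M"
    unfolding M_def by (rule prob_space_return) simp
  have sp: "space M = {a}"
    by (simp add: M_def)
  have "nonadaptive_alg n 0 M"
    using ps by (simp add: nonadaptive_alg_def sp queries_def a_def)
  moreover have "approximates_lis_length \<epsilon> n M"
    unfolding approximates_lis_length_def
  proof
    fix A :: "nat \<Rightarrow> real"
    have "\<bar>real n / 2 - real (lis_length n A)\<bar> \<le> 1 / 2 * real n"
      using lis_length_le[of n A] by linarith
    also have "\<dots> \<le> \<epsilon> * real n"
      using assms by (intro mult_right_mono) auto
    finally have "{b \<in> space M. \<bar>estimate b A - real (lis_length n A)\<bar> \<le> \<epsilon> * real n} = space M"
      by (auto simp: sp estimate_def a_def)
    then show "measure M {b \<in> space M. \<bar>estimate b A - real (lis_length n A)\<bar> \<le> \<epsilon> * real n} \<ge> 2 / 3"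
      using prob_space.prob_space[OF ps] by simp
  qed
  ultimately show ?thesis
    by blast
qed

end

theory Submission
  imports Defs "HOL-Real_Asymp.Real_Asymp"
begin

text \<open>By averaging over a finitely supported input distribution, it suffices to fool one
  deterministic algorithm with query set \<open>Q\<close>. Positions \<open>0, \<dots>, k\<^sup>h - 1\<close> are the leaves of a \<open>k\<close>-ary
  tree of height \<open>h \<approx> log n\<close>, and \<open>t \<approx> log (1/\<epsilon>)\<close> of its levels, chosen at random, are special. At
  the other levels the children of a node increase. Every node above the last special level
  carries a bit, hidden in its subtree. At the last special level the bit decides whether (most)
  children form increasing or decreasing runs; at an earlier one it is the exclusive or of
  the bits of two siblings arranged in decreasing order, of which only the longer LIS counts.
  The relative gap between the LIS lengths for the two bits shrinks by about a factor 4 per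
  special level, so it stays above \<open>2\<epsilon>\<close>. In each case the part of the array below a single child has the same distribution
  for both bits. Hence the bit of the root affects the answers only if \<open>Q\<close> contains a subtree
  branching at all special levels, and a set of \<open>q\<close> leaves does so for at most \<open>q\<^sup>2\<close> choices of
  the special levels, out of about \<open>(log n)\<^sup>t\<close>.\<close>

subsection \<open>Capturing special levels\<close>

definition child :: "nat \<Rightarrow> nat set \<Rightarrow> nat \<Rightarrow> nat set" where
  "child m Q i = {y. y < m \<and> i * m + y \<in> Q}"

lemma finite_child [simp]: "finite (child m Q i)"
  by (rule finite_subset[of _ "{..<m}"]) (auto simp: child_def)

lemma sum_card_child: "(\<Sum>i<k. card (child m Q i)) = card (Q \<inter> {..<k * m})"
proof (cases "m = 0")
  case False
  have "card (SIGMA i:{..<k}. child m Q i) = card (Q \<inter> {..<k * m})"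
  proof (rule bij_betw_same_card[OF bij_betw_byWitness[where f' = "\<lambda>x. (x div m, x mod m)"]])
    show "(\<lambda>(i, y). i * m + y) ` (SIGMA i:{..<k}. child m Q i) \<subseteq> Q \<inter> {..<k * m}"
    proof (rule image_subsetI, unfold case_prod_beta)
      fix p assume "p \<in> (SIGMA i:{..<k}. child m Q i)"
      then have p: "fst p < k" "snd p < m" "fst p * m + snd p \<in> Q"
        by (auto simp: child_def)
      then have "fst p * m + snd p < Suc (fst p) * m"
        by simp
      also have "\<dots> \<le> k * m"
        using p(1) by (intro mult_le_mono1) simp
      finally show "fst p * m + snd p \<in> Q \<inter> {..<k * m}"
        using p(3) by simp
    qed
  qed (use False in \<open>auto simp: child_def less_mult_imp_div_less\<close>)
  then show ?thesis
    by simp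
qed (auto simp: child_def)

text \<open>A word lists the levels from the root down; \<open>True\<close> marks the special ones. A single induction
  bounds the captured words for all numbers of special levels at once.\<close>

primrec captured :: "nat \<Rightarrow> bool list \<Rightarrow> nat set \<Rightarrow> bool" where
  "captured k [] Q \<longleftrightarrow> Q \<noteq> {}"
| "captured k (c # w) Q \<longleftrightarrow>
     (\<exists>i<k. \<exists>j<k. (c \<longrightarrow> i \<noteq> j) \<and> captured k w (child (k ^ length w) Q i) \<and>
        captured k w (child (k ^ length w) Q j))"

lemma card_captured_le:
  assumes "finite Q"
  shows "card {w. length w = h \<and> captured k w Q} \<le> (card Q)\<^sup>2"
  using assms
proof (induction h arbitrary: Q)
  case 0
  show ?case
  proof (cases "Q = {}")
    case False
    then have "1 \<le> card Q"
      using 0 by (simp add: Suc_leI card_gt_0_iff)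
    moreover have "{w. length w = 0 \<and> captured k w Q} = {[]}"
      using False by auto
    ultimately show ?thesis
      by simp
  qed simp
next
  case (Suc h)
  define C where "C = child (k ^ h) Q"
  define W where "W = (\<lambda>i. {w. length w = h \<and> captured k w (C i)})"
  define q where "q = (\<lambda>i. card (C i))"
  have fin: "finite (W i)" for i
    by (rule finite_subset[OF _ finite_lists_length_eq[of UNIV h]]) (auto simp: W_def)
  have W: "card (W i) \<le> (q i)\<^sup>2" for i
    unfolding W_def q_def by (rule Suc.IH) (simp add: C_def)
  have "{w. length w = Suc h \<and> captured k w Q} \<subseteq>
      (\<Union>(i, j)\<in>{..<k} \<times> {..<k}. Cons (i \<noteq> j) ` (W i \<inter> W j))"
  proof safe
    fix w assume "length w = Suc h" "captured k w Q"
    then obtain c v where "w = c # v" "length v = h"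
      by (auto simp: length_Suc_conv)
    with \<open>captured k w Q\<close> obtain i j where ij: "i < k" "j < k" "c \<longrightarrow> i \<noteq> j" "v \<in> W i" "v \<in> W j"
      by (auto simp: W_def C_def)
    show "w \<in> (\<Union>(i, j)\<in>{..<k} \<times> {..<k}. Cons (i \<noteq> j) ` (W i \<inter> W j))"
    proof (cases c)
      case True
      then show ?thesis using ij \<open>w = c # v\<close> by (intro UN_I[of "(i, j)"]) auto
    next
      case False
      then show ?thesis using ij \<open>w = c # v\<close> by (intro UN_I[of "(i, i)"]) auto
    qed
  qed
  then have "card {w. length w = Suc h \<and> captured k w Q} \<le>
      card (\<Union>(i, j)\<in>{..<k} \<times> {..<k}. Cons (i \<noteq> j) ` (W i \<inter> W j))"
    using fin by (intro card_mono) auto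
  also have "\<dots> \<le> (\<Sum>(i, j)\<in>{..<k} \<times> {..<k}. card (Cons (i \<noteq> j) ` (W i \<inter> W j)))"
    by (rule order.trans[OF card_UN_le]) (simp_all add: case_prod_beta)
  also have "\<dots> \<le> (\<Sum>(i, j)\<in>{..<k} \<times> {..<k}. q i * q j)"
  proof (rule sum_mono, clarsimp)
    fix i j
    have "card (W i \<inter> W j) \<le> card (W i)" "card (W i \<inter> W j) \<le> card (W j)"
      using fin by (auto intro: card_mono)
    then have "card (W i \<inter> W j) * card (W i \<inter> W j) \<le> (q i)\<^sup>2 * (q j)\<^sup>2"
      using W[of i] W[of j] by (intro mult_le_mono) linarith+
    then have "(card (W i \<inter> W j))\<^sup>2 \<le> (q i * q j)\<^sup>2"
      by (simp add: power2_eq_square mult_ac)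
    then show "card (Cons (i \<noteq> j) ` (W i \<inter> W j)) \<le> q i * q j"
      by (simp add: card_image power2_nat_le_eq_le)
  qed
  also have "\<dots> = (\<Sum>i<k. q i)\<^sup>2"
    by (simp add: power2_eq_square sum_product sum.cartesian_product)
  also have "\<dots> \<le> (card Q)\<^sup>2"
    using Suc.prems by (auto simp: q_def C_def sum_card_child intro!: power_mono card_mono)
  finally show ?case .
qed

subsection \<open>The hard distribution\<close>

text \<open>Below, \<open>b\<close> is the bit of a node and \<open>s\<close> its random seed; \<open>rank\<close> orders the values of its \<open>d\<^sup>3\<close>
  children and \<open>label\<close> is the bit passed on to child \<open>i\<close>.

  \<^item> \<open>Swap\<close> reverses the order in each pair of children \<open>2p, 2p + 1\<close>; their bits differ iff \<open>b\<close>.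
    Pairs with odd \<open>p\<close> carry the complementary bits, so that for \<open>\<not> b\<close> exactly half of the pairs have two
    \<open>True\<close> bits and no concentration argument is needed.

  \<^item> \<open>Shift\<close> splits the children into \<open>d\<^sup>2\<close> groups of \<open>d\<close>, each running up or down from a shifted
    starting point modulo \<open>d\<^sup>2\<close>. The shift makes the rank of a single child uniform in its
    range, and as it takes each value in exactly one group, few groups wrap around.\<close>

datatype gadget = Plain | Swap | Shift

definition gadget_at :: "bool \<Rightarrow> bool list \<Rightarrow> gadget" where
  "gadget_at c w = (if \<not> c then Plain else if True \<in> set w then Swap else Shift)"

fun seeds :: "nat \<Rightarrow> gadget \<Rightarrow> nat set" where
  "seeds d Plain = {0}"
| "seeds d Swap = {0, 1}"
| "seeds d Shift = {..<d\<^sup>2}"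

fun rank :: "nat \<Rightarrow> gadget \<Rightarrow> bool \<Rightarrow> nat \<Rightarrow> nat \<Rightarrow> nat" where
  "rank d Plain b s i = i"
| "rank d Swap b s i = (if even i then i + 1 else i - 1)"
| "rank d Shift b s i = i div d * d\<^sup>2 +
     (s + i div d + (if b then i mod d else d\<^sup>2 - i mod d)) mod d\<^sup>2"

fun label :: "gadget \<Rightarrow> bool \<Rightarrow> nat \<Rightarrow> nat \<Rightarrow> bool" where
  "label Plain b s i = b"
| "label Swap b s i = ((s = 0) \<noteq> (odd (i div 2) \<noteq> (b \<and> odd i)))"
| "label Shift b s i = True"

lemma finite_seeds [simp]: "finite (seeds d g)"
  by (cases g) auto

lemma seeds_nonempty [simp]: "d > 0 \<Longrightarrow> seeds d g \<noteq> {}"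
  by (cases g) (auto simp: lessThan_empty_iff)

definition combine :: "nat \<Rightarrow> (nat \<Rightarrow> nat \<Rightarrow> nat) \<Rightarrow> nat \<Rightarrow> nat" where
  "combine m f x = f (x div m) (x mod m)"

text \<open>All levels below the last special one are \<open>Plain\<close>, so the bit that \<open>Shift\<close> passes on is irrelevant.\<close>

primrec arrays :: "nat \<Rightarrow> bool list \<Rightarrow> bool \<Rightarrow> (nat \<Rightarrow> nat) pmf" where
  "arrays d [] b = return_pmf (\<lambda>_. 0)"
| "arrays d (c # w) b =
     do {
       s \<leftarrow> pmf_of_set (seeds d (gadget_at c w));
       f \<leftarrow> Pi_pmf {..<d ^ 3} (\<lambda>_. 0)
              (\<lambda>i. map_pmf (\<lambda>A x. rank d (gadget_at c w) b s i * (d ^ 4) ^ length w + A x)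
                     (arrays d w (label (gadget_at c w) b s i)));
       return_pmf (combine ((d ^ 3) ^ length w) f)
     }"

definition view :: "nat set \<Rightarrow> (nat \<Rightarrow> nat) \<Rightarrow> nat \<Rightarrow> nat" where
  "view Q A = (\<lambda>x. if x \<in> Q then A x else 0)"

lemma view_combine:
  "m > 0 \<Longrightarrow> view Q (combine m f) = combine m (\<lambda>i. view (child m Q i) (f i))"
  by (auto simp: view_def combine_def child_def fun_eq_iff)

lemma map_Pi_pmf_dependent:
  assumes "finite I" "\<And>i. i \<notin> I \<Longrightarrow> g i d = d"
  shows "map_pmf (\<lambda>f i. g i (f i)) (Pi_pmf I d p) = Pi_pmf I d (\<lambda>i. map_pmf (g i) (p i))"
proof -
  have "Pi_pmf I d (\<lambda>i. map_pmf (g i) (p i)) =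
      bind_pmf (Pi_pmf I d p) (\<lambda>f. return_pmf (\<lambda>i. if i \<in> I then g i (f i) else d))"
    unfolding map_pmf_def
    by (subst Pi_pmf_bind[OF assms(1), where d' = d]) (simp add: assms(1))
  also have "\<dots> = map_pmf (\<lambda>f i. g i (f i)) (Pi_pmf I d p)"
    unfolding map_pmf_def
  proof (rule bind_pmf_cong[OF refl])
    fix f assume "f \<in> set_pmf (Pi_pmf I d p)"
    then have "f i = d" if "i \<notin> I" for i
      using set_Pi_pmf_subset[OF assms(1), of d p] that by auto
    then show "return_pmf (\<lambda>i. if i \<in> I then g i (f i) else d) = return_pmf (\<lambda>i. g i (f i))"
      using assms(2) by (auto simp: fun_eq_iff)
  qed
  finally show ?thesis ..
qed

lemma bind_Pi_pmf_single:
  assumes "finite I" "i0 \<in> I"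
    and "\<And>s i. s \<in> set_pmf S \<Longrightarrow> i \<in> I \<Longrightarrow> i \<noteq> i0 \<Longrightarrow> V s i = C i"
  shows "bind_pmf S (\<lambda>s. Pi_pmf I d (V s)) = Pi_pmf I d (C(i0 := bind_pmf S (\<lambda>s. V s i0)))"
proof -
  define J where "J = I - {i0}"
  have J: "I = insert i0 J" "finite J" "i0 \<notin> J"
    using assms by (auto simp: J_def)
  have "bind_pmf S (\<lambda>s. Pi_pmf I d (V s)) =
      bind_pmf S (\<lambda>s. do {y \<leftarrow> V s i0; f \<leftarrow> Pi_pmf J d C; return_pmf (f(i0 := y))})"
  proof (rule bind_pmf_cong[OF refl])
    fix s assume "s \<in> set_pmf S"
    then have "Pi_pmf J d (V s) = Pi_pmf J d C"
      using assms(3) J by (intro Pi_pmf_cong) auto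
    then show "Pi_pmf I d (V s) = do {y \<leftarrow> V s i0; f \<leftarrow> Pi_pmf J d C; return_pmf (f(i0 := y))}"
      using J by (simp add: Pi_pmf_insert')
  qed
  also have "\<dots> = do {y \<leftarrow> bind_pmf S (\<lambda>s. V s i0); f \<leftarrow> Pi_pmf J d C; return_pmf (f(i0 := y))}"
    by (simp add: bind_assoc_pmf)
  also have "\<dots> = do {y \<leftarrow> bind_pmf S (\<lambda>s. V s i0);
      f \<leftarrow> Pi_pmf J d (C(i0 := bind_pmf S (\<lambda>s. V s i0))); return_pmf (f(i0 := y))}"
    using J by (intro bind_pmf_cong refl) (auto intro!: Pi_pmf_cong)
  also have "\<dots> = Pi_pmf I d (C(i0 := bind_pmf S (\<lambda>s. V s i0)))"
    using J by (simp add: Pi_pmf_insert')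
  finally show ?thesis .
qed

lemma inj_on_add_mod: "inj_on (\<lambda>s. (s + c) mod N) {..<N :: nat}"
proof (rule inj_onI)
  fix x y assume "x \<in> {..<N}" "y \<in> {..<N}" "(x + c) mod N = (y + c) mod N"
  moreover have "x mod N = y mod N"
    using \<open>(x + c) mod N = (y + c) mod N\<close> nat_mod_eq_iff by auto
  ultimately show "x = y"
    by simp
qed

lemma map_pmf_of_set_add_mod:
  assumes "(N :: nat) > 0"
  shows "map_pmf (\<lambda>s. (s + c) mod N) (pmf_of_set {..<N}) = pmf_of_set {..<N}"
proof -
  have "(\<lambda>s. (s + c) mod N) ` {..<N} \<subseteq> {..<N}"
    using assms by auto
  then have "(\<lambda>s. (s + c) mod N) ` {..<N} = {..<N}"
    using inj_on_add_mod[of c N] by (simp add: endo_inj_surj)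
  with inj_on_add_mod[of c N] assms show ?thesis
    by (subst map_pmf_of_set_inj) auto
qed

lemma gadget_hides:
  assumes "d > 0" "g \<noteq> Plain"
  shows "map_pmf (\<lambda>s. (rank d g b s i, label g b s i)) (pmf_of_set (seeds d g)) =
    map_pmf (\<lambda>s. (rank d g b' s i, label g b' s i)) (pmf_of_set (seeds d g))"
proof (cases g)
  case Swap
  have "map_pmf (\<lambda>s. (s = 0) \<noteq> x) (pmf_of_set {0, 1 :: nat}) = pmf_of_set UNIV" for x
    by (subst map_pmf_of_set_inj) (auto simp: inj_on_def UNIV_bool intro!: arg_cong[of _ _ pmf_of_set])
  note flip = this
  have "map_pmf (\<lambda>s. (rank d Swap b s i, label Swap b s i)) (pmf_of_set {0, 1}) =
      map_pmf (\<lambda>y. (if even i then i + 1 else i - 1, y)) (pmf_of_set UNIV)" for b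
    by (simp only: flip[of "odd (i div 2) \<noteq> (b \<and> odd i)", symmetric] map_pmf_comp rank.simps label.simps)
  then show ?thesis
    using Swap by simp
next
  case Shift
  have "map_pmf (\<lambda>s. (rank d Shift b s i, label Shift b s i)) (pmf_of_set {..<d\<^sup>2}) =
      map_pmf (\<lambda>y. (i div d * d\<^sup>2 + y, True)) (pmf_of_set {..<d\<^sup>2})" for b
  proof -
    have "map_pmf (\<lambda>y. (i div d * d\<^sup>2 + y, True)) (pmf_of_set {..<d\<^sup>2}) = 
      map_pmf (\<lambda>y. (i div d * d\<^sup>2 + y, True))
        (map_pmf (\<lambda>s. (s + (i div d + (if b then i mod d else d\<^sup>2 - i mod d))) mod d\<^sup>2) (pmf_of_set {..<d\<^sup>2}))"
      using assms(1) by (subst map_pmf_of_set_add_mod) auto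
    then show ?thesis
      by (simp add: map_pmf_comp add.assoc)
  qed
  then show ?thesis
    using Shift by simp
qed (use assms in simp)

lemma gadget_at_simps [simp]:
  "gadget_at False w = Plain"
  "True \<in> set w \<Longrightarrow> gadget_at True w = Swap"
  "True \<notin> set w \<Longrightarrow> gadget_at True w = Shift"
  by (simp_all add: gadget_at_def)

lemma arrays_without_True: "True \<notin> set w \<Longrightarrow> arrays d w b = arrays d w b'"
proof (induction w arbitrary: b b')
  case (Cons c w)
  then have "c = False" "True \<notin> set w"
    by auto
  with Cons.IH[of b b'] show ?case
    by simp
qed simp

lemma captured_without_True:
  assumes "True \<notin> set w" "Q \<subseteq> {..<k ^ length w}" "Q \<noteq> {}"
  shows "captured k w Q"
  using assms
proof (induction w arbitrary: Q)
  case (Cons c w)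
  define m where "m = k ^ length w"
  obtain x where x: "x \<in> Q" "x < k * m"
    using Cons.prems by (auto simp: m_def)
  then have "x div m < k" and m: "m > 0"
    by (auto simp: less_mult_imp_div_less intro!: Nat.gr0I)
  moreover have "x mod m \<in> child m Q (x div m)"
    using x m by (simp add: child_def)
  then have "captured k w (child m Q (x div m))"
    using Cons.prems by (intro Cons.IH) (auto simp: child_def m_def)
  ultimately show ?case
    using Cons.prems(1) by (auto simp: m_def)
qed simp

lemma views_agree:
  assumes "d > 0" "True \<in> set w" "\<not> captured (d ^ 3) w Q"
  shows "map_pmf (view Q) (arrays d w b) = map_pmf (view Q) (arrays d w b')"
  using assms(2,3)
proof (induction w arbitrary: Q b b')
  case (Cons c w)
  define k m B g where "k = d ^ 3" "m = k ^ length w" "B = (d ^ 4) ^ length w"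
    and g: "g = gadget_at c w"
  note kmB = this(1-3)
  define C where "C = child m Q"
  define S where "S = pmf_of_set (seeds d g)"
  define F where "F = (\<lambda>i (r, a).
    map_pmf (\<lambda>A. view (C i) (\<lambda>x. r * B + A x)) (map_pmf (view (C i)) (arrays d w a)))"
  have "m > 0" "k > 0"
    using assms(1) by (auto simp: kmB)
  have view_view: "view (C i) (\<lambda>x. r * B + view (C i) A x) = view (C i) (\<lambda>x. r * B + A x)" for i r A
    by (auto simp: view_def)
  have expand: "map_pmf (view Q) (arrays d (c # w) b) = map_pmf (combine m)
      (bind_pmf S (\<lambda>s. Pi_pmf {..<k} (\<lambda>_. 0) (\<lambda>i. F i (rank d g b s i, label g b s i))))" for b
  proof -
    have prod: "map_pmf (\<lambda>f. combine m (\<lambda>i. view (C i) (f i))) (Pi_pmf {..<k} (\<lambda>_. 0) p) =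
        map_pmf (combine m) (Pi_pmf {..<k} (\<lambda>_. 0) (\<lambda>i. map_pmf (view (C i)) (p i)))" for p
      by (subst map_Pi_pmf_dependent[symmetric]) (auto simp: view_def map_pmf_comp)
    have "map_pmf (view Q) (arrays d (c # w) b) = bind_pmf S (\<lambda>s. map_pmf (view Q \<circ> combine m)
      (Pi_pmf {..<k} (\<lambda>_. 0) (\<lambda>i. map_pmf (\<lambda>A x. rank d g b s i * B + A x)
                     (arrays d w (label g b s i)))))"
      by (simp add: map_bind_pmf S_def g kmB map_pmf_def bind_assoc_pmf bind_return_pmf)
    also have "view Q \<circ> combine m = combine m \<circ> (\<lambda>f i. view (C i) (f i))"
      using \<open>m > 0\<close> by (auto simp: fun_eq_iff view_combine C_def)
    finally show ?thesis
      by (simp add: map_bind_pmf F_def map_pmf_comp view_view prod)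
  qed
  have agree: "F i (r, a) = F i (r, a')" if "True \<in> set w \<longrightarrow> \<not> captured k w (C i)" for i r a a'
  proof -
    have "map_pmf (view (C i)) (arrays d w a) = map_pmf (view (C i)) (arrays d w a')"
    proof (cases "True \<in> set w")
      case True
      then show ?thesis using that by (intro Cons.IH) (auto simp: kmB)
    next
      case False
      then show ?thesis by (metis arrays_without_True)
    qed
    then show ?thesis by (simp add: F_def)
  qed
  have unc: "\<not> captured k w (C i) \<or> \<not> captured k w (C j)" if "i < k" "j < k" "c \<longrightarrow> i \<noteq> j" for i j
    using Cons.prems(2) that by (auto simp: kmB C_def)
  show ?case
  proof (cases c)
    case False
    then have "Pi_pmf {..<k} (\<lambda>_. 0) (\<lambda>i. F i (rank d g b s i, label g b s i)) =
        Pi_pmf {..<k} (\<lambda>_. 0) (\<lambda>i. F i (rank d g b' s i, label g b' s i))" for s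
      using unc by (intro Pi_pmf_cong refl) (auto simp: g intro!: agree)
    then show ?thesis
      by (simp only: expand)
  next
    case True
    obtain i0 where i0: "i0 < k" and others: "\<And>i. i < k \<Longrightarrow> i \<noteq> i0 \<Longrightarrow> \<not> captured k w (C i)"
      using unc True \<open>k > 0\<close> by metis
    have const: "F i (rank d g b s i, label g b s i) = F i (rank d g True 0 i, True)"
      if "i < k" "i \<noteq> i0" for b s i
    proof (cases "True \<in> set w")
      case True
      then show ?thesis using others[OF that] \<open>c\<close> by (auto simp: g intro!: agree)
    next
      case False
      have "C i \<subseteq> {..<k ^ length w}"
        by (auto simp: C_def child_def kmB)
      then have "C i = {}"
        using captured_without_True[OF False] others[OF that] by auto
      then have "view (C i) = (\<lambda>_ _. 0)"
        by (auto simp: view_def fun_eq_iff)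
      then show ?thesis
        by (simp add: F_def)
    qed
    have "bind_pmf S (\<lambda>s. Pi_pmf {..<k} (\<lambda>_. 0) (\<lambda>i. F i (rank d g b s i, label g b s i))) =
        Pi_pmf {..<k} (\<lambda>_. 0) ((\<lambda>i. F i (rank d g True 0 i, True))
          (i0 := bind_pmf S (\<lambda>s. F i0 (rank d g b s i0, label g b s i0))))" for b
      using i0 const by (intro bind_Pi_pmf_single) auto
    moreover have "bind_pmf S (\<lambda>s. F i0 (rank d g b s i0, label g b s i0)) =
        bind_pmf S (\<lambda>s. F i0 (rank d g b' s i0, label g b' s i0))"
    proof -
      have "bind_pmf S (\<lambda>s. F i0 (rank d g b s i0, label g b s i0)) =
        bind_pmf (map_pmf (\<lambda>s. (rank d g b s i0, label g b s i0)) S) (F i0)" for b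
        by (simp add: bind_map_pmf)
      moreover have "g \<noteq> Plain"
        using \<open>c\<close> by (simp add: g gadget_at_def)
      ultimately show ?thesis
        using gadget_hides[OF assms(1), of g b i0 b'] by (simp add: S_def)
    qed
    ultimately show ?thesis
      by (simp only: expand)
  qed
qed simp

subsection \<open>Increasing subsequences of the hard arrays\<close>

definition lis_le :: "(nat \<Rightarrow> nat) \<Rightarrow> nat \<Rightarrow> real \<Rightarrow> bool" where
  "lis_le A M r \<longleftrightarrow> (\<forall>L \<subseteq> {..<M}. mono_on L A \<longrightarrow> real (card L) \<le> r)"

definition lis_ge :: "(nat \<Rightarrow> nat) \<Rightarrow> nat \<Rightarrow> real \<Rightarrow> bool" where
  "lis_ge A M r \<longleftrightarrow> (\<exists>L \<subseteq> {..<M}. mono_on L A \<and> r \<le> real (card L))"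

lemma child_block:
  assumes "y \<in> child m L i" "i < j" "y' \<in> child m L j"
  shows "i * m + y < j * m + y'"
proof -
  have "i * m + y < Suc i * m"
    using assms(1) by (simp add: child_def)
  also have "\<dots> \<le> j * m"
    using assms(2) by (intro mult_le_mono1) simp
  finally show ?thesis by simp
qed

lemma combine_at: "y < m \<Longrightarrow> combine m f (i * m + y) = f i y"
  by (simp add: combine_def)

lemma lis_le_combine:
  assumes A: "\<And>x. x < k * m \<Longrightarrow> A x = combine m (\<lambda>i y. \<rho> i * B + f i y) x"
    and bd: "\<And>i y. i < k \<Longrightarrow> y < m \<Longrightarrow> f i y < B"
    and u: "\<And>i. i < k \<Longrightarrow> lis_le (f i) m (u i)"
    and r: "\<And>I. I \<subseteq> {..<k} \<Longrightarrow> mono_on I \<rho> \<Longrightarrow> (\<Sum>i\<in>I. u i) \<le> r"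
  shows "lis_le A (k * m) r"
  unfolding lis_le_def
proof (intro allI impI)
  fix L assume L: "L \<subseteq> {..<k * m}" and mono: "mono_on L A"
  define I where "I = {i. i < k \<and> child m L i \<noteq> {}}"
  have val: "A (i * m + y) = \<rho> i * B + f i y" if "y \<in> child m L i" for i y
    using that L by (subst A) (auto simp: child_def combine_at)
  have "mono_on I \<rho>"
  proof (rule mono_onI)
    fix i j assume "i \<in> I" "j \<in> I" "i \<le> j"
    show "\<rho> i \<le> \<rho> j"
    proof (cases "i = j")
      case False
      obtain y y' where y: "y \<in> child m L i" "y' \<in> child m L j" "i < k" "j < k"
        using \<open>i \<in> I\<close> \<open>j \<in> I\<close> by (auto simp: I_def)
      have "i * m + y < j * m + y'"
        using child_block[OF y(1) _ y(2)] False \<open>i \<le> j\<close> by simp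
      then have "A (i * m + y) \<le> A (j * m + y')"
        using y by (intro mono_onD[OF mono]) (auto simp: child_def)
      then have "\<rho> i * B + f i y \<le> \<rho> j * B + f j y'"
        using y by (simp add: val)
      also have "\<dots> < Suc (\<rho> j) * B"
        using bd[of j y'] y by (simp add: child_def)
      finally have "\<rho> i * B < Suc (\<rho> j) * B"
        by linarith
      then show ?thesis
        by (metis less_Suc_eq_le mult_less_cancel2)
    qed simp
  qed
  have card: "real (card (child m L i)) \<le> u i" if "i < k" for i
  proof -
    have "mono_on (child m L i) (f i)"
    proof (rule mono_onI)
      fix y y' assume y: "y \<in> child m L i" "y' \<in> child m L i" "y \<le> y'"
      then have "A (i * m + y) \<le> A (i * m + y')"
        by (intro mono_onD[OF mono]) (auto simp: child_def)
      then show "f i y \<le> f i y'"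
        using y by (simp add: val)
    qed
    moreover have "child m L i \<subseteq> {..<m}"
      by (auto simp: child_def)
    ultimately show ?thesis
      using u[OF that] by (simp add: lis_le_def)
  qed
  have "real (card L) = (\<Sum>i<k. real (card (child m L i)))"
    using L by (simp add: sum_card_child Int_absorb2 flip: of_nat_sum)
  also have "\<dots> = (\<Sum>i\<in>I. real (card (child m L i)))"
    by (intro sum.mono_neutral_right) (auto simp: I_def)
  also have "\<dots> \<le> (\<Sum>i\<in>I. u i)"
    by (intro sum_mono card) (auto simp: I_def)
  also have "\<dots> \<le> r"
    using \<open>mono_on I \<rho>\<close> by (intro r) (auto simp: I_def)
  finally show "real (card L) \<le> r" .
qed

lemma lis_ge_combine:
  assumes A: "\<And>x. x < k * m \<Longrightarrow> A x = combine m (\<lambda>i y. \<rho> i * B + f i y) x"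
    and bd: "\<And>i y. i < k \<Longrightarrow> y < m \<Longrightarrow> f i y < B"
    and I: "I \<subseteq> {..<k}" "strict_mono_on I \<rho>"
    and l: "\<And>i. i \<in> I \<Longrightarrow> lis_ge (f i) m (l i)"
  shows "lis_ge A (k * m) (\<Sum>i\<in>I. l i)"
proof -
  have "\<forall>i\<in>I. \<exists>L \<subseteq> {..<m}. mono_on L (f i) \<and> l i \<le> real (card L)"
    using l by (auto simp: lis_ge_def)
  then obtain T where T: "\<And>i. i \<in> I \<Longrightarrow> T i \<subseteq> {..<m}" "\<And>i. i \<in> I \<Longrightarrow> mono_on (T i) (f i)"
      "\<And>i. i \<in> I \<Longrightarrow> l i \<le> real (card (T i))"
    by metis
  define L where "L = {x. x < k * m \<and> x div m \<in> I \<and> x mod m \<in> T (x div m)}"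
  have block: "i * m + y < k * m" if "i \<in> I" "y < m" for i y
  proof -
    have "i * m + y < Suc i * m"
      using that by simp
    also have "\<dots> \<le> k * m"
      using that I by (intro mult_le_mono1) (auto simp: Suc_le_eq)
    finally show ?thesis .
  qed
  have childL: "child m L i = (if i \<in> I then T i else {})" for i
  proof -
    have "(i * m + y) div m = i" "(i * m + y) mod m = y" if "y < m" for y
      using that by auto
    then show ?thesis
      using subsetD[OF T(1), of i] block
      by (auto simp: child_def L_def simp del: div_mult_self3 div_mult_self4)
  qed
  have "mono_on L A"
  proof (rule mono_onI)
    fix x x' assume x: "x \<in> L" "x' \<in> L" "x \<le> x'"
    define i y i' y' where iy: "i = x div m" "y = x mod m" "i' = x' div m" "y' = x' mod m"
    have mem: "i \<in> I" "i' \<in> I" "y \<in> T i" "y' \<in> T i'" and le: "i \<le> i'"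
      using x by (auto simp: L_def iy div_le_mono)
    have lt: "y < m" "y' < m" "i < k" "i' < k"
      using mem T(1) I by auto
    have val: "A x = \<rho> i * B + f i y" "A x' = \<rho> i' * B + f i' y'"
      using x A by (auto simp: L_def combine_def iy)
    show "A x \<le> A x'"
    proof (cases "i = i'")
      case True
      then have "y \<le> y'"
        using \<open>x \<le> x'\<close> by (metis iy div_mult_mod_eq nat_add_left_cancel_le)
      then show ?thesis
        using mono_onD[OF T(2)] mem True by (simp add: val)
    next
      case False
      then have "\<rho> i < \<rho> i'"
        using le mem by (intro strict_mono_onD[OF I(2)]) auto
      then have "Suc (\<rho> i) * B \<le> \<rho> i' * B"
        by (intro mult_le_mono1) simp
      then show ?thesis
        using bd[of i y] lt by (simp add: val)
    qed
  qed
  moreover have "L \<subseteq> {..<k * m}"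
    by (auto simp: L_def)
  moreover have "(\<Sum>i\<in>I. l i) \<le> real (card L)"
  proof -
    have "(\<Sum>i\<in>I. l i) \<le> (\<Sum>i\<in>I. real (card (child m L i)))"
      using T(3) by (intro sum_mono) (simp add: childL)
    also have "\<dots> = (\<Sum>i<k. real (card (child m L i)))"
      using I(1) by (intro sum.mono_neutral_left) (auto simp: childL)
    also have "\<dots> = real (card L)"
      using \<open>L \<subseteq> {..<k * m}\<close> by (simp add: sum_card_child Int_absorb2 flip: of_nat_sum)
    finally show ?thesis .
  qed
  ultimately show ?thesis
    by (auto simp: lis_ge_def)
qed

lemma in_arrays_Cons:
  assumes "A \<in> set_pmf (arrays d (c # w) b)" "d > 0"
  obtains s f where "s \<in> seeds d (gadget_at c w)"
    "\<And>i. i < d ^ 3 \<Longrightarrow> f i \<in> set_pmf (arrays d w (label (gadget_at c w) b s i))"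
    "\<And>x. x < d ^ 3 * (d ^ 3) ^ length w \<Longrightarrow>
       A x = combine ((d ^ 3) ^ length w)
               (\<lambda>i y. rank d (gadget_at c w) b s i * (d ^ 4) ^ length w + f i y) x"
proof -
  define g m where "g = gadget_at c w" and "m = (d ^ 3) ^ length w"
  obtain s h where s: "s \<in> seeds d g" and A: "A = combine m h"
    and "h \<in> set_pmf (Pi_pmf {..<d ^ 3} (\<lambda>_. 0) (\<lambda>i. map_pmf (\<lambda>A x.
           rank d g b s i * (d ^ 4) ^ length w + A x) (arrays d w (label g b s i))))"
    using assms(1) seeds_nonempty[OF assms(2), of g] by (auto simp flip: g_def m_def)
  then have "\<forall>i<d ^ 3. \<exists>F \<in> set_pmf (arrays d w (label g b s i)).
      h i = (\<lambda>y. rank d g b s i * (d ^ 4) ^ length w + F y)"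
    by (auto simp: set_Pi_pmf PiE_dflt_def)
  then obtain f where "\<And>i. i < d ^ 3 \<Longrightarrow> f i \<in> set_pmf (arrays d w (label g b s i)) \<and>
        h i = (\<lambda>y. rank d g b s i * (d ^ 4) ^ length w + f i y)"
    by metis
  then show ?thesis
    using s by (intro that[of s f]) (simp_all add: A combine_def less_mult_imp_div_less
        flip: m_def g_def)
qed

lemma rank_less:
  assumes "even d" "i < d ^ 3"
  shows "rank d g b s i < d ^ 4"
proof -
  have "d > 0"
    using assms(2) by (auto intro: Nat.gr0I)
  then have k: "d ^ 3 \<le> d ^ 4"
    by (intro power_increasing) auto
  show ?thesis
  proof (cases g)
    case Swap
    have "even (d ^ 3)"
      using assms(1) by simp
    then have "i + 1 \<noteq> d ^ 3" if "even i"
      using that by (metis even_plus_one_iff)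
    then show ?thesis
      using Swap assms(2) k by auto
  next
    case Shift
    have "i div d < d\<^sup>2"
      using assms(2) by (simp add: less_mult_imp_div_less power2_eq_square power3_eq_cube mult.assoc)
    moreover have "(s + i div d + (if b then i mod d else d\<^sup>2 - i mod d)) mod d\<^sup>2 < d\<^sup>2"
      using \<open>d > 0\<close> by simp
    ultimately have "rank d g b s i < Suc (i div d) * d\<^sup>2"
      using Shift by simp
    also have "\<dots> \<le> d\<^sup>2 * d\<^sup>2"
      using \<open>i div d < d\<^sup>2\<close> by (intro mult_le_mono1) simp
    finally show ?thesis
      by (simp flip: power_add)
  qed (use assms k in simp)
qed

lemma arrays_less:
  assumes "even d" "d > 0" "A \<in> set_pmf (arrays d w b)" "x < (d ^ 3) ^ length w"
  shows "A x < (d ^ 4) ^ length w"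
  using assms(3,4)
proof (induction w arbitrary: A b x)
  case (Cons c w)
  define m g where "m = (d ^ 3) ^ length w" and "g = gadget_at c w"
  obtain s f where "s \<in> seeds d g"
    and f: "\<And>i. i < d ^ 3 \<Longrightarrow> f i \<in> set_pmf (arrays d w (label g b s i))"
    and "\<And>x. x < d ^ 3 * m \<Longrightarrow>
       A x = combine m (\<lambda>i y. rank d g b s i * (d ^ 4) ^ length w + f i y) x"
    by (rule in_arrays_Cons[OF Cons.prems(1) assms(2), folded m_def g_def]) (rule that)
  then have A: "A x = combine m (\<lambda>i y. rank d g b s i * (d ^ 4) ^ length w + f i y) x"
    using Cons.prems(2) by (simp add: m_def)
  have "x div m < d ^ 3" "x mod m < m"
    using Cons.prems(2) assms(2) by (auto simp: m_def less_mult_imp_div_less)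
  then have "f (x div m) (x mod m) < (d ^ 4) ^ length w"
    using Cons.IH[OF f] by (simp add: m_def)
  then have "A x < Suc (rank d g b s (x div m)) * (d ^ 4) ^ length w"
    by (simp add: A combine_def)
  also have "\<dots> \<le> d ^ 4 * (d ^ 4) ^ length w"
    using rank_less[OF assms(1) \<open>x div m < d ^ 3\<close>] by (intro mult_le_mono1) (simp add: Suc_le_eq)
  finally show ?case
    by simp
qed simp

fun upper :: "nat \<Rightarrow> nat \<Rightarrow> bool \<Rightarrow> real" where
  "upper d 0 b = 1"
| "upper d (Suc t) b = (if b then 1 else 1 - (1 - 2 / real d) / 2 ^ t) / 2 ^ t"

fun lower :: "nat \<Rightarrow> nat \<Rightarrow> bool \<Rightarrow> real" where
  "lower d 0 b = 1"
| "lower d (Suc t) b = (if b then (1 - 1 / real d) / 2 ^ t else 0)"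

lemma upper_nonneg: "0 \<le> upper d t b"
proof (cases t)
  case (Suc t')
  have "(1 - 2 / real d) / 2 ^ t' \<le> 1 / 1"
    by (intro frac_le) auto
  then show ?thesis
    using Suc by auto
qed simp

lemma mult_div_less: "n > 0 \<Longrightarrow> i < n * m \<Longrightarrow> i div n < (m :: nat)"
  by (simp add: less_mult_imp_div_less mult.commute)

lemma sum_parity: "(\<Sum>p<2 * e. f (odd p)) = real e * (f True + f False)"
  by (induction e) (auto simp: algebra_simps)

lemma sum_Swap_upper:
  assumes "d \<ge> 2" and I: "I \<subseteq> {..<4 * e}" "mono_on I (rank d Swap b s)"
  shows "(\<Sum>i\<in>I. upper d (Suc t) (label Swap b s i)) \<le> real (4 * e) * upper d (Suc (Suc t)) b"
proof -
  define v where "v = (\<lambda>p :: nat. if b then 1 / 2 ^ t else upper d (Suc t) ((s = 0) \<noteq> odd p))"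
  have v: "upper d (Suc t) (label Swap b s i) \<le> v (i div 2)" "0 \<le> v p" for i p
  proof -
    have "(1 - (1 - 2 / real d) / 2 ^ t) / 2 ^ t \<le> 1 / 2 ^ t"
      using assms(1) by (intro divide_right_mono) auto
    then show "upper d (Suc t) (label Swap b s i) \<le> v (i div 2)" "0 \<le> v p"
      using upper_nonneg[of d "Suc t"] by (auto simp: v_def)
  qed
  have "inj_on (\<lambda>i. i div 2) I"
  proof (rule inj_onI, rule ccontr)
    fix i j assume ij: "i \<in> I" "j \<in> I" "i div 2 = j div 2" "i \<noteq> j"
    then have "False" if "i < j" "i \<in> I" "j \<in> I" "i div 2 = j div 2" for i j
    proof -
      have "even i" "j = i + 1"
        using that(1,4) by presburger+
      then show False
        using mono_onD[OF I(2), of i j] that by auto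
    qed
    then show False
      using ij by (metis linorder_neqE_nat)
  qed
  have "(\<Sum>i\<in>I. upper d (Suc t) (label Swap b s i)) \<le> (\<Sum>i\<in>I. v (i div 2))"
    by (intro sum_mono v)
  also have "\<dots> = (\<Sum>p\<in>(\<lambda>i. i div 2) ` I. v p)"
    using \<open>inj_on (\<lambda>i. i div 2) I\<close> by (simp add: sum.reindex)
  also have "\<dots> \<le> (\<Sum>p<2 * e. v p)"
    using I(1) by (intro sum_mono2 v) (auto intro: mult_div_less)
  also have "\<dots> = real (4 * e) * upper d (Suc (Suc t)) b"
  proof (cases b)
    case True
    then show ?thesis by (simp add: v_def)
  next
    case False
    then have "(\<Sum>p<2 * e. v p) = (\<Sum>p<2 * e. upper d (Suc t) ((s = 0) \<noteq> odd p))"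
      by (simp add: v_def)
    also have "\<dots> = real e * (upper d (Suc t) True + upper d (Suc t) False)"
      by (subst sum_parity[of "\<lambda>x. upper d (Suc t) ((s = 0) \<noteq> x)"]) simp
    also have "\<dots> = real (4 * e) * upper d (Suc (Suc t)) b"
    proof -
      have "e * (1 / P + (1 - x / P) / P) = 4 * e * ((1 - x / (2 * P)) / (2 * P))"
        if "P > 0" for e x P :: real
        using that by (simp add: field_simps)
      from this[of "2 ^ t" "real e" "1 - 2 / real d"] show ?thesis
        using False by simp
    qed
    finally show ?thesis .
  qed
  finally show ?thesis .
qed

lemma sum_Swap_lower:
  "\<exists>I \<subseteq> {..<4 * e}. strict_mono_on I (rank d Swap b s) \<and>
     real (4 * e) * lower d (Suc (Suc t)) b \<le> (\<Sum>i\<in>I. lower d (Suc t) (label Swap b s i))"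
proof (cases b)
  case True
  define I where "I = {i. i < 4 * e \<and> label Swap b s i}"
  have pair: "label Swap b s (2 * p + 1) \<longleftrightarrow> \<not> label Swap b s (2 * p)" for p
    using True by simp
  have "strict_mono_on I (rank d Swap b s)"
  proof (rule strict_mono_onI)
    fix i j assume ij: "i \<in> I" "j \<in> I" "i < j"
    have "i div 2 \<noteq> j div 2"
    proof
      assume "i div 2 = j div 2"
      then have "i = 2 * (i div 2)" "j = 2 * (i div 2) + 1"
        using ij(3) by presburger+
      then show False
        using ij pair[of "i div 2"] unfolding I_def by force
    qed
    then have "i div 2 < j div 2"
      using ij(3) by (simp add: div_le_mono order.strict_iff_order)
    then show "rank d Swap b s i < rank d Swap b s j"
      using ij(3) by auto presburger+
  qed
  moreover have "card {..<2 * e} \<le> card I"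
  proof (rule card_inj_on_le)
    let ?f = "\<lambda>p. if label Swap b s (2 * p) then 2 * p else 2 * p + 1"
    show "inj_on ?f {..<2 * e}"
      by (rule inj_on_inverseI[where g = "\<lambda>i. i div 2"]) (simp del: label.simps)
    show "?f ` {..<2 * e} \<subseteq> I"
    proof (rule image_subsetI)
      fix p assume "p \<in> {..<2 * e}"
      then have "2 * p + 1 < 4 * e"
        by simp
      then show "?f p \<in> I"
        using pair[of p] by (simp add: I_def del: label.simps)
    qed
  qed (simp add: I_def)
  moreover have "real (4 * e) * lower d (Suc (Suc t)) b \<le> (\<Sum>i\<in>I. lower d (Suc t) (label Swap b s i))"
    if "real (2 * e) \<le> real (card I)"
  proof -
    have "0 \<le> lower d (Suc t) True"
      by (cases "d = 0") auto
    then have "real (2 * e) * lower d (Suc t) True \<le> real (card I) * lower d (Suc t) True"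
      using that by (intro mult_right_mono)
    also have "\<dots> = (\<Sum>i\<in>I. lower d (Suc t) (label Swap b s i))"
      by (simp add: I_def del: label.simps)
    finally show ?thesis
      using True by simp
  qed
  ultimately show ?thesis
    by (intro exI[of _ I]) (auto simp: I_def)
next
  case False
  then show ?thesis
    by (intro exI[of _ "{}"]) auto
qed

lemma rank_Shift_False:
  assumes "d > 0"
  shows "rank d Shift False s i = i div d * d\<^sup>2 +
    (if i mod d \<le> (s + i div d) mod d\<^sup>2 then (s + i div d) mod d\<^sup>2 - i mod d
     else (s + i div d) mod d\<^sup>2 + d\<^sup>2 - i mod d)"
proof -
  define w j where "w = (s + i div d) mod d\<^sup>2" and "j = i mod d"
  have "j < d" "w < d\<^sup>2" "d \<le> d\<^sup>2"
    using assms by (auto simp: w_def j_def power2_eq_square)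
  have "(s + i div d + (d\<^sup>2 - j)) mod d\<^sup>2 = (w + (d\<^sup>2 - j)) mod d\<^sup>2"
    by (simp add: w_def mod_simps)
  also have "\<dots> = (if j \<le> w then w - j else w + d\<^sup>2 - j)"
  proof (cases "j \<le> w")
    case True
    then have "w + (d\<^sup>2 - j) = (w - j) + d\<^sup>2"
      using \<open>j < d\<close> \<open>d \<le> d\<^sup>2\<close> by simp
    then have "(w + (d\<^sup>2 - j)) mod d\<^sup>2 = (w - j) mod d\<^sup>2"
      by (simp only: mod_add_self2)
    then show ?thesis
      using True \<open>w < d\<^sup>2\<close> by (simp only: if_True) simp
  next
    case False
    then show ?thesis
      using \<open>j < d\<close> \<open>d \<le> d\<^sup>2\<close> by simp
  qed
  finally show ?thesis
    by (simp add: w_def j_def)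
qed

lemma card_Shift_False:
  assumes "d > 0" "I \<subseteq> {..<d ^ 3}" "mono_on I (rank d Shift False s)"
  shows "card I \<le> 2 * d\<^sup>2"
proof -
  have k: "d ^ 3 = d * d\<^sup>2"
    by (simp add: power2_eq_square power3_eq_cube)
  define h where "h = (\<lambda>i. (i div d, i mod d \<le> (s + i div d) mod d\<^sup>2))"
  have "card I \<le> card ({..<d\<^sup>2} \<times> (UNIV :: bool set))"
  proof (rule card_inj_on_le)
    show "inj_on h I"
    proof (rule inj_onI, rule ccontr)
      fix i j assume ij: "i \<in> I" "j \<in> I" "h i = h j" "i \<noteq> j"
      have "False" if "i < j" "i \<in> I" "j \<in> I" "h i = h j" for i j
      proof -
        have "i div d = j div d"
          using that by (simp add: h_def)
        then have "i mod d < j mod d"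
          using \<open>i < j\<close> by (metis div_mult_mod_eq nat_add_left_cancel_less)
        moreover have "j mod d < d" "d \<le> d\<^sup>2"
          using assms(1) by (auto simp: power2_eq_square)
        ultimately have "rank d Shift False s j < rank d Shift False s i"
          using that \<open>i div d = j div d\<close> unfolding rank_Shift_False[OF assms(1)] h_def
          by auto
        then show False
          using mono_onD[OF assms(3), of i j] that by simp
      qed
      then show False
        using ij by (metis linorder_neqE_nat)
    qed
    show "h ` I \<subseteq> {..<d\<^sup>2} \<times> UNIV"
      using assms(1,2) by (auto simp: h_def k intro!: mult_div_less)
  qed simp
  then show ?thesis
    by (simp add: card_cartesian_product)
qed

lemma card_Shift_True:
  assumes "d > 0"
  shows "\<exists>I \<subseteq> {..<d ^ 3}. strict_mono_on I (rank d Shift True s) \<and> d ^ 3 \<le> card I + d\<^sup>2"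
proof (intro exI[of _ "{i. i < d ^ 3 \<and> (s + i div d) mod d\<^sup>2 + d \<le> d\<^sup>2}"] conjI)
  let ?w = "\<lambda>i. (s + i div d) mod d\<^sup>2"
  define I where "I = {i. i < d ^ 3 \<and> ?w i + d \<le> d\<^sup>2}"
  have rk: "rank d Shift True s i = i div d * d\<^sup>2 + (?w i + i mod d)"
    and less: "?w i + i mod d < d\<^sup>2" if "i \<in> I" for i
  proof -
    have "i mod d < d"
      using assms by simp
    then show less: "?w i + i mod d < d\<^sup>2"
      using that unfolding I_def by simp
    have "(s + i div d + i mod d) mod d\<^sup>2 = (?w i + i mod d) mod d\<^sup>2"
      by (simp add: mod_simps)
    then show "rank d Shift True s i = i div d * d\<^sup>2 + (?w i + i mod d)"
      using less by simp
  qed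
  show "strict_mono_on {i. i < d ^ 3 \<and> ?w i + d \<le> d\<^sup>2} (rank d Shift True s)"
    unfolding I_def[symmetric]
  proof (rule strict_mono_onI)
    fix i j assume ij: "i \<in> I" "j \<in> I" "i < j"
    show "rank d Shift True s i < rank d Shift True s j"
    proof (cases "i div d = j div d")
      case True
      then have "i mod d < j mod d"
        using \<open>i < j\<close> by (metis div_mult_mod_eq nat_add_left_cancel_less)
      then show ?thesis
        using True ij by (simp add: rk del: rank.simps)
    next
      case False
      then have "i div d < j div d"
        using \<open>i < j\<close> by (simp add: div_le_mono order.strict_iff_order)
      then have "Suc (i div d) * d\<^sup>2 \<le> j div d * d\<^sup>2"
        by (intro mult_le_mono1) simp
      then show ?thesis
        using ij less[of i] by (simp add: rk del: rank.simps)
    qed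
  qed
  have k: "d ^ 3 = d * d\<^sup>2"
    by (simp add: power2_eq_square power3_eq_cube)
  define J where "J = {..<d ^ 3} - I"
  have "card J \<le> card ({d\<^sup>2 - d<..<d\<^sup>2} \<times> {..<d})"
  proof (rule card_inj_on_le)
    show "inj_on (\<lambda>i. (?w i, i mod d)) J"
    proof (rule inj_onI)
      fix i j assume ij: "i \<in> J" "j \<in> J" "(?w i, i mod d) = (?w j, j mod d)"
      have "i div d < d\<^sup>2" "j div d < d\<^sup>2"
        using ij assms by (auto simp: J_def k intro!: mult_div_less)
      then have "i div d = j div d"
        using ij(3) inj_onD[OF inj_on_add_mod[of s "d\<^sup>2"], of "i div d" "j div d"]
        by (simp add: add.commute)
      then show "i = j"
        using ij(3) by (metis div_mult_mod_eq prod.inject)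
    qed
    show "(\<lambda>i. (?w i, i mod d)) ` J \<subseteq> {d\<^sup>2 - d<..<d\<^sup>2} \<times> {..<d}"
      using assms self_le_power[of d 2] by (auto simp: J_def I_def)
  qed simp
  also have "\<dots> \<le> d * d"
    using assms by (auto simp: card_cartesian_product)
  finally have "card J \<le> d\<^sup>2"
    by (simp add: power2_eq_square)
  moreover have "card J = d ^ 3 - card I"
    unfolding J_def by (subst card_Diff_subset) (auto simp: I_def)
  ultimately show "d ^ 3 \<le> card {i. i < d ^ 3 \<and> ?w i + d \<le> d\<^sup>2} + d\<^sup>2"
    unfolding I_def by simp
qed auto

lemma gadget_upper:
  assumes d: "even d" "d > 0" and I: "I \<subseteq> {..<d ^ 3}" "mono_on I (rank d (gadget_at c w) b s)"
  shows "(\<Sum>i\<in>I. upper d (count_list w True) (label (gadget_at c w) b s i)) \<le>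
    real (d ^ 3) * upper d (count_list (c # w) True) b"
proof -
  have "card I \<le> d ^ 3"
    using card_mono[OF _ I(1)] by simp
  then have cI: "real (card I) \<le> real (d ^ 3)"
    by linarith
  show ?thesis
  proof (cases c)
    case False
    then show ?thesis
      using cI upper_nonneg[of d "count_list w True" b] by (simp add: mult_right_mono del: of_nat_power)
  next
    case True
    show ?thesis
    proof (cases "True \<in> set w")
      case inner: True
      then obtain t where t: "count_list w True = Suc t"
        by (metis count_list_0_iff not0_implies_Suc)
      obtain e where "d = 2 * e"
        using d(1) by blast
      then have "d ^ 3 = 4 * (2 * e ^ 3)"
        by (simp add: power_mult_distrib)
      then show ?thesis
        using sum_Swap_upper[of d I "2 * e ^ 3" b s t] I d(2) \<open>d = 2 * e\<close> inner t \<open>c\<close> by (simp del: upper.simps label.simps)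
    next
      case False
      then have t: "count_list w True = 0"
        by simp
      show ?thesis
      proof (cases b)
        case True
        then show ?thesis
          using t cI \<open>c\<close> False by simp
      next
        case b: False
        have "card I \<le> 2 * d\<^sup>2"
          using card_Shift_False[OF d(2), of I s] I \<open>c\<close> False b by simp
        then have "real (card I) \<le> real (2 * d\<^sup>2)"
          by linarith
        also have "\<dots> = real (d ^ 3) * (2 / real d)"
          using d(2) by (simp add: power2_eq_square power3_eq_cube)
        finally show ?thesis
          using t \<open>c\<close> False b by simp
      qed
    qed
  qed
qed

lemma gadget_lower:
  assumes d: "even d" "d > 0"
  shows "\<exists>I \<subseteq> {..<d ^ 3}. strict_mono_on I (rank d (gadget_at c w) b s) \<and>
    real (d ^ 3) * lower d (count_list (c # w) True) b \<le>
      (\<Sum>i\<in>I. lower d (count_list w True) (label (gadget_at c w) b s i))"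
proof (cases c)
  case False
  then show ?thesis
    by (intro exI[of _ "{..<d ^ 3}"]) (auto intro!: strict_mono_onI)
next
  case True
  show ?thesis
  proof (cases "True \<in> set w")
    case inner: True
    then obtain t where t: "count_list w True = Suc t"
      by (metis count_list_0_iff not0_implies_Suc)
    obtain e where "d = 2 * e"
      using d(1) by blast
    then have k: "d ^ 3 = 4 * (2 * e ^ 3)"
      by (simp add: power_mult_distrib)
    show ?thesis
      using sum_Swap_lower[of "2 * e ^ 3" d b s t] inner t \<open>c\<close> k by (simp del: lower.simps label.simps rank.simps)
  next
    case False
    then have t: "count_list w True = 0"
      by simp
    show ?thesis
    proof (cases b)
      case True
      obtain I where I: "I \<subseteq> {..<d ^ 3}" "strict_mono_on I (rank d Shift True s)" "d ^ 3 \<le> card I + d\<^sup>2"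
        using card_Shift_True[OF d(2)] by blast
      then have "real (d ^ 3) \<le> real (card I) + real (d\<^sup>2)"
        by linarith
      moreover have "real (d ^ 3) * (1 - 1 / real d) = real (d ^ 3) - real (d\<^sup>2)"
        using d(2) by (simp add: power2_eq_square power3_eq_cube field_simps)
      ultimately show ?thesis
        using t \<open>c\<close> False True I by (intro exI[of _ I]) (simp del: rank.simps)
    next
      case b: False
      then show ?thesis
        using \<open>c\<close> t by (intro exI[of _ "{}"]) simp
    qed
  qed
qed

lemma lis_ge_mono: "lis_ge A M r \<Longrightarrow> r' \<le> r \<Longrightarrow> lis_ge A M r'"
  by (meson lis_ge_def order.trans)

lemma arrays_lis:
  assumes d: "even d" "d > 0" and A: "A \<in> set_pmf (arrays d w b)"
  shows "lis_le A ((d ^ 3) ^ length w) (real ((d ^ 3) ^ length w) * upper d (count_list w True) b)"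
    and "lis_ge A ((d ^ 3) ^ length w) (real ((d ^ 3) ^ length w) * lower d (count_list w True) b)"
proof -
  have "lis_le A ((d ^ 3) ^ length w) (real ((d ^ 3) ^ length w) * upper d (count_list w True) b) \<and>
    lis_ge A ((d ^ 3) ^ length w) (real ((d ^ 3) ^ length w) * lower d (count_list w True) b)"
    using A
  proof (induction w arbitrary: A b)
    case Nil
    have "card L \<le> 1" if "L \<subseteq> {..<Suc 0}" for L
      using card_mono[OF _ that] by simp
    then show ?case
      by (auto simp: lis_le_def lis_ge_def mono_on_def intro!: exI[of _ "{..<Suc 0}"])
  next
    case (Cons c w)
    define m g where "m = (d ^ 3) ^ length w" and "g = gadget_at c w"
    define t where "t = count_list w True"
    obtain s f where "s \<in> seeds d g"
      and f: "\<And>i. i < d ^ 3 \<Longrightarrow> f i \<in> set_pmf (arrays d w (label g b s i))"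
      and Aeq: "\<And>x. x < d ^ 3 * m \<Longrightarrow>
         A x = combine m (\<lambda>i y. rank d g b s i * (d ^ 4) ^ length w + f i y) x"
      by (rule in_arrays_Cons[OF Cons.prems d(2), folded m_def g_def]) (rule that)
    have bd: "f i y < (d ^ 4) ^ length w" if "i < d ^ 3" "y < m" for i y
      using arrays_less[OF d f] that by (simp add: m_def)
    have IH: "lis_le (f i) m (real m * upper d t (label g b s i))"
      "lis_ge (f i) m (real m * lower d t (label g b s i))" if "i < d ^ 3" for i
      using Cons.IH[OF f[OF that]] by (simp_all add: m_def t_def)
    have "lis_le A (d ^ 3 * m) (real m * (real (d ^ 3) * upper d (count_list (c # w) True) b))"
      by (rule lis_le_combine[OF Aeq bd IH(1)])
        (auto simp flip: sum_distrib_left simp: g_def t_def simp del: count_list.simps of_nat_power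
           intro!: mult_left_mono gadget_upper d)
    moreover obtain I where I: "I \<subseteq> {..<d ^ 3}" "strict_mono_on I (rank d g b s)"
      "real (d ^ 3) * lower d (count_list (c # w) True) b \<le> (\<Sum>i\<in>I. lower d t (label g b s i))"
      using gadget_lower[OF d, of c w b s] unfolding g_def t_def by blast
    have "lis_ge A (d ^ 3 * m) (\<Sum>i\<in>I. real m * lower d t (label g b s i))"
      using I by (intro lis_ge_combine[OF Aeq bd I(1,2)] IH(2)) auto
    then have "lis_ge A (d ^ 3 * m) (real m * (real (d ^ 3) * lower d (count_list (c # w) True) b))"
      by (rule lis_ge_mono) (use mult_left_mono[OF I(3), of "real m"] in \<open>simp add: sum_distrib_left\<close>)
    ultimately show ?case
      by (simp add: m_def mult_ac del: count_list.simps)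
  qed
  then show "lis_le A ((d ^ 3) ^ length w) (real ((d ^ 3) ^ length w) * upper d (count_list w True) b)"
    "lis_ge A ((d ^ 3) ^ length w) (real ((d ^ 3) ^ length w) * lower d (count_list w True) b)"
    by auto
qed

subsection \<open>From hard arrays to query lower bounds\<close>

lemma finite_increasing_cards: "finite {card L | L. increasing_indices n A L}"
proof -
  have "{card L | L. increasing_indices n A L} \<subseteq> card ` Pow {1..n}"
    by (auto simp: increasing_indices_def)
  then show ?thesis
    by (rule finite_subset) simp
qed

lemma card_le_lis_length: "increasing_indices n A L \<Longrightarrow> card L \<le> lis_length n A"
  unfolding lis_length_def using finite_increasing_cards by (intro Max_ge) auto

lemma lis_length_attained: "\<exists>L. increasing_indices n A L \<and> card L = lis_length n A"
proof -
  have "increasing_indices n A {}"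
    by (simp add: increasing_indices_def)
  then have "lis_length n A \<in> {card L | L. increasing_indices n A L}"
    unfolding lis_length_def using finite_increasing_cards by (intro Max_in) auto
  then show ?thesis
    by auto
qed

definition spread :: "nat \<Rightarrow> nat \<Rightarrow> (nat \<Rightarrow> nat) \<Rightarrow> nat \<Rightarrow> real" where
  "spread W K A p = (if p \<in> {1..K * W} then real (A ((p - 1) div W)) else 0)"

lemma lis_length_spread_ge:
  assumes "lis_ge A K r" "K * W \<le> n"
  shows "real W * r \<le> real (lis_length n (spread W K A))"
proof -
  obtain T where T: "T \<subseteq> {..<K}" "mono_on T A" "r \<le> real (card T)"
    using assms(1) by (auto simp: lis_ge_def)
  define X where "X = {x. x < K * W \<and> x div W \<in> T}"
  have child: "child W X i = (if i \<in> T then {..<W} else {})" if "i < K" for i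
  proof -
    have "i * W + y < K * W" if "y < W" for y
    proof -
      have "i * W + y < Suc i * W"
        using that by simp
      also have "\<dots> \<le> K * W"
        using \<open>i < K\<close> by (intro mult_le_mono1) simp
      finally show ?thesis .
    qed
    then show ?thesis
      by (auto simp: child_def X_def)
  qed
  have "card X = (\<Sum>i<K. card (child W X i))"
    by (subst sum_card_child) (auto simp: X_def intro!: arg_cong[of _ _ card])
  also have "\<dots> = (\<Sum>i<K. if i \<in> T then W else 0)"
    by (intro sum.cong) (auto simp: child)
  also have "\<dots> = card T * W"
    using T(1) by (simp add: sum.If_cases Int_absorb1)
  finally have X: "card X = card T * W" .
  have "increasing_indices n (spread W K A) (Suc ` X)"
    using assms(2) T(2)
    by (auto simp: increasing_indices_def spread_def X_def mono_on_def div_le_mono)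
  then have "card (Suc ` X) \<le> lis_length n (spread W K A)"
    by (rule card_le_lis_length)
  then have "real (card T) * real W \<le> real (lis_length n (spread W K A))"
    by (simp add: card_image X flip: of_nat_mult)
  then show ?thesis
    using mult_left_mono[OF T(3), of "real W"] by (simp add: mult.commute)
qed

lemma lis_length_spread_le:
  assumes "lis_le A K r" "n = K * W + R"
  shows "real (lis_length n (spread W K A)) \<le> real W * r + real R"
proof -
  obtain L where L: "increasing_indices n (spread W K A) L" "card L = lis_length n (spread W K A)"
    using lis_length_attained by blast
  define X where "X = {x. x < K * W \<and> Suc x \<in> L}"
  define I where "I = {i. i < K \<and> child W X i \<noteq> {}}"
  have "mono_on I A"
  proof (rule mono_onI)
    fix i j assume ij: "i \<in> I" "j \<in> I" "i \<le> j"
    then obtain y y' where y: "y \<in> child W X i" "y' \<in> child W X j"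
      by (auto simp: I_def)
    show "A i \<le> A j"
    proof (cases "i = j")
      case False
      then have less: "i * W + y < j * W + y'"
        using child_block[OF y(1) _ y(2)] ij(3) by simp
      have "spread W K A (Suc (i * W + y)) \<le> spread W K A (Suc (j * W + y'))"
        using L(1) y less unfolding increasing_indices_def child_def X_def by auto
      moreover have "(i * W + y) div W = i" "(j * W + y') div W = j"
        using y by (auto simp: child_def)
      ultimately show ?thesis
        using y by (simp add: spread_def child_def X_def Suc_le_eq)
    qed simp
  qed
  moreover have "I \<subseteq> {..<K}"
    by (auto simp: I_def)
  ultimately have I: "real (card I) \<le> r"
    using assms(1) by (simp add: lis_le_def)
  have "card X = (\<Sum>i<K. card (child W X i))"
    by (subst sum_card_child) (auto simp: X_def intro!: arg_cong[of _ _ card])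
  also have "\<dots> = (\<Sum>i\<in>I. card (child W X i))"
    by (intro sum.mono_neutral_right) (auto simp: I_def)
  also have "\<dots> \<le> (\<Sum>i\<in>I. card {..<W})"
    by (intro sum_mono card_mono) (auto simp: child_def)
  finally have X: "card X \<le> card I * W"
    by simp
  have "L \<subseteq> Suc ` X \<union> {K * W<..n}"
  proof
    fix p assume "p \<in> L"
    moreover from this have "1 \<le> p" "p \<le> n"
      using L(1) by (auto simp: increasing_indices_def)
    ultimately show "p \<in> Suc ` X \<union> {K * W<..n}"
      by (cases p) (auto simp: X_def)
  qed
  then have "card L \<le> card (Suc ` X \<union> {K * W<..n})"
    by (intro card_mono) (auto simp: X_def)
  also have "\<dots> \<le> card X + R"
    using card_Un_le[of "Suc ` X" "{K * W<..n}"] assms(2) by (simp add: card_image)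
  finally have "card L \<le> card I * W + R"
    using X by simp
  then have "real (card L) \<le> real (card I) * real W + real R"
    by (metis of_nat_add of_nat_le_iff of_nat_mult)
  also have "\<dots> \<le> r * real W + real R"
    using I by (intro add_right_mono mult_right_mono) auto
  finally show ?thesis
    by (simp add: L(2) mult.commute)
qed

lemma finite_set_arrays: "d > 0 \<Longrightarrow> finite (set_pmf (arrays d w b))"
proof (induction w arbitrary: b)
  case (Cons c w)
  then show ?case
    by (auto simp: set_Pi_pmf intro!: finite_PiE_dflt)
qed simp

text \<open>Only the events \<open>C a A\<close> with fixed \<open>A\<close> are known to be measurable in \<open>a\<close>, which is why the
  distributions have finite support: their expectations are finite sums.\<close>

lemma pmf_averaging:
  fixes P :: "'j \<Rightarrow> 'b pmf"
  assumes "prob_space M" "finite J"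
    and fin: "\<And>j. j \<in> J \<Longrightarrow> finite (set_pmf (P j))"
    and c: "c > 0" "\<And>A. c \<le> measure M {a \<in> space M. C a A}"
  shows "\<exists>a\<in>space M. c * real (card J) \<le> (\<Sum>j\<in>J. measure_pmf.prob (P j) {A. C a A})"
proof (rule ccontr)
  interpret prob_space M by fact
  define E where "E = (\<lambda>A. {a \<in> space M. C a A})"
  define f where "f = (\<lambda>a. \<Sum>j\<in>J. \<Sum>A\<in>set_pmf (P j). pmf (P j) A * indicator (E A) a)"
  assume "\<not> ?thesis"
  moreover have "(\<Sum>j\<in>J. measure_pmf.prob (P j) {A. C a A}) = f a" if "a \<in> space M" for a
  proof -
    have "measure_pmf.prob (P j) {A. C a A} = (\<Sum>A\<in>set_pmf (P j). pmf (P j) A * indicator (E A) a)"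
      if "j \<in> J" for j
    proof -
      have "measure_pmf.prob (P j) {A. C a A} = measure_pmf.prob (P j) ({A. C a A} \<inter> set_pmf (P j))"
        by (simp add: measure_Int_set_pmf)
      also have "\<dots> = (\<Sum>A\<in>{A. C a A} \<inter> set_pmf (P j). pmf (P j) A)"
        using fin[OF that] by (intro measure_measure_pmf_finite) auto
      also have "\<dots> = (\<Sum>A\<in>set_pmf (P j). pmf (P j) A * indicator (E A) a)"
        using fin[OF that] \<open>a \<in> space M\<close>
        by (intro sum.mono_neutral_cong_left) (auto simp: E_def indicator_def)
      finally show ?thesis .
    qed
    then show ?thesis
      by (simp add: f_def)
  qed
  ultimately have less: "f a < c * real (card J)" if "a \<in> space M" for a
    using that by force
  have E: "E A \<in> sets M" for A
    using c(1) c(2)[of A] by (metis E_def measure_notin_sets not_less)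
  have summand: "integrable M (\<lambda>a. pmf (P j) A * indicator (E A) a)"
    "integral\<^sup>L M (\<lambda>a. pmf (P j) A * indicator (E A) a) = pmf (P j) A * measure M (E A)" for j A
    using E[of A] by (auto intro!: integrable_mult_right integrable_real_indicator simp: less_top[symmetric])
  have int: "integrable M f"
    unfolding f_def by (intro Bochner_Integration.integrable_sum summand)
  have "c * real (card J) = (\<Sum>j\<in>J. \<Sum>A\<in>set_pmf (P j). pmf (P j) A * c)"
    using fin by (simp add: sum_pmf_eq_1 flip: sum_distrib_right)
  also have "\<dots> \<le> (\<Sum>j\<in>J. \<Sum>A\<in>set_pmf (P j). pmf (P j) A * measure M (E A))"
    using c(2) by (intro sum_mono mult_left_mono) (auto simp: E_def)
  also have "\<dots> = integral\<^sup>L M f"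
    unfolding f_def
    by (simp only: summand Bochner_Integration.integral_sum[OF summand(1)]
        Bochner_Integration.integral_sum[OF Bochner_Integration.integrable_sum[OF summand(1)]])
  also have "\<dots> < integral\<^sup>L M (\<lambda>_. c * real (card J))"
    using int less by (intro integral_less_AE_space) (auto simp: emeasure_space_1)
  also have "\<dots> = c * real (card J)"
    by (simp add: prob_space)
  finally show False
    by simp
qed

lemma card_words: "card {w. length w = h \<and> count_list w True = t} = h choose t"
proof (induction h arbitrary: t)
  case 0
  have "{w. length w = 0 \<and> count_list w True = t} = (if t = 0 then {[]} else {})"
    by auto
  then show ?case
    by (cases t) auto
next
  case (Suc h)
  define J where "J = (\<lambda>t. {w. length w = h \<and> count_list w True = t})"
  have fin: "finite (J t)" for t
    by (rule finite_subset[OF _ finite_lists_length_eq[of UNIV h]]) (auto simp: J_def)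
  have J: "card (J t) = h choose t" for t
    unfolding J_def by (rule Suc.IH)
  show ?case
  proof (cases t)
    case 0
    have "{w. length w = Suc h \<and> count_list w True = t} = Cons False ` J 0"
      by (auto simp: 0 J_def length_Suc_conv split: if_splits)
    then show ?thesis
      by (simp add: card_image J 0)
  next
    case (Suc t')
    have "{w. length w = Suc h \<and> count_list w True = t} = Cons False ` J t \<union> Cons True ` J t'"
      by (auto simp: Suc J_def length_Suc_conv split: if_splits)
    moreover have "card (Cons False ` J t \<union> Cons True ` J t') = card (J t) + card (J t')"
      using fin by (subst card_Un_disjoint) (auto simp: card_image)
    ultimately show ?thesis
      by (simp add: J Suc)
  qed
qed

lemma uncaptured_confuses:
  fixes d W n R :: nat and w :: "bool list" and a :: det_nonadaptive and \<epsilon> :: real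
  defines "K \<equiv> (d ^ 3) ^ length w"
  defines "C \<equiv> {A. \<bar>estimate a (spread W K A) - real (lis_length n (spread W K A))\<bar> \<le> \<epsilon> * real n}"
  assumes d: "even d" "d > 0" and w: "True \<in> set w" and n: "n = K * W + R"
    and uncaptured: "\<not> captured (d ^ 3) w ((\<lambda>p. (p - 1) div W) ` (set (queries a) \<inter> {1..K * W}))"
    and gap: "real (K * W) * upper d (count_list w True) False + real R + 2 * \<epsilon> * real n
      < real (K * W) * lower d (count_list w True) True"
  shows "measure_pmf.prob (arrays d w True) C + measure_pmf.prob (arrays d w False) C \<le> 1"
proof -
  define Q where "Q = (\<lambda>p. (p - 1) div W) ` (set (queries a) \<inter> {1..K * W})"
  define e where "e = (\<lambda>A. estimate a (spread W K A))"
  define \<theta> where "\<theta> = real (K * W) * lower d (count_list w True) True - \<epsilon> * real n"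
  define S where "S = {A. \<theta> \<le> e A}"
  have "spread W K A p = spread W K (view Q A) p" if "p \<in> set (queries a)" for A p
    using that by (auto simp: spread_def view_def Q_def)
  then have "map (spread W K A) (queries a) = map (spread W K (view Q A)) (queries a)" for A
    by (intro map_cong refl)
  then have "e A = e (view Q A)" for A
    unfolding e_def estimate_def by metis
  then have viewed: "measure_pmf.prob (arrays d w b) S = measure_pmf.prob (map_pmf (view Q) (arrays d w b)) S" for b
    by (auto simp: S_def vimage_def)
  have same: "measure_pmf.prob (arrays d w True) S = measure_pmf.prob (arrays d w False) S"
    using viewed[of True] viewed[of False]
      views_agree[OF d(2) w uncaptured[folded Q_def], of True False] by metis
  have "C \<inter> set_pmf (arrays d w True) \<subseteq> S"
  proof
    fix A assume "A \<in> C \<inter> set_pmf (arrays d w True)"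
    then have A: "A \<in> set_pmf (arrays d w True)"
      "\<bar>e A - real (lis_length n (spread W K A))\<bar> \<le> \<epsilon> * real n"
      by (auto simp: C_def e_def)
    have "real W * (real K * lower d (count_list w True) True) \<le> real (lis_length n (spread W K A))"
      using arrays_lis(2)[OF d A(1)] n by (intro lis_length_spread_ge) (auto simp: K_def)
    then show "A \<in> S"
      using A(2) by (simp add: S_def \<theta>_def mult_ac)
  qed
  then have "measure_pmf.prob (arrays d w True) C \<le> measure_pmf.prob (arrays d w True) S"
    by (subst measure_Int_set_pmf[symmetric]) (intro measure_pmf.finite_measure_mono, auto)
  moreover have "C \<inter> set_pmf (arrays d w False) \<subseteq> - S"
  proof
    fix A assume "A \<in> C \<inter> set_pmf (arrays d w False)"
    then have A: "A \<in> set_pmf (arrays d w False)"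
      "\<bar>e A - real (lis_length n (spread W K A))\<bar> \<le> \<epsilon> * real n"
      by (auto simp: C_def e_def)
    have "real (lis_length n (spread W K A)) \<le>
        real W * (real K * upper d (count_list w True) False) + real R"
      using arrays_lis(1)[OF d A(1)] n by (intro lis_length_spread_le) (auto simp: K_def)
    then show "A \<in> - S"
      using A(2) gap by (simp add: S_def \<theta>_def mult_ac)
  qed
  then have "measure_pmf.prob (arrays d w False) C \<le> measure_pmf.prob (arrays d w False) (- S)"
    by (subst measure_Int_set_pmf[symmetric]) (intro measure_pmf.finite_measure_mono, auto)
  moreover have "measure_pmf.prob (arrays d w False) (- S) = 1 - measure_pmf.prob (arrays d w False) S"
    using measure_pmf.prob_compl[of S "arrays d w False"] by (simp add: Compl_eq_Diff_UNIV)
  ultimately show ?thesis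
    using same by linarith
qed

lemma query_bound:
  assumes M: "nonadaptive_alg n q M" "approximates_lis_length \<epsilon> n M"
    and d: "even d" "d > 0" and "t > 0" and n: "n = (d ^ 3) ^ h * W + R"
    and gap: "real ((d ^ 3) ^ h * W) * upper d t False + real R + 2 * \<epsilon> * real n
      < real ((d ^ 3) ^ h * W) * lower d t True"
  shows "h choose t \<le> 3 * q\<^sup>2"
proof -
  define K where "K = (d ^ 3) ^ h"
  define J where "J = {w. length w = h \<and> count_list w True = t}"
  define C where "C = (\<lambda>(a :: det_nonadaptive) A.
    \<bar>estimate a (spread W K A) - real (lis_length n (spread W K A))\<bar> \<le> \<epsilon> * real n)"
  define pr where "pr = (\<lambda>a (w, b). measure_pmf.prob (arrays d w b) {A. C a A})"
  have finJ: "finite J"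
    by (rule finite_subset[OF _ finite_lists_length_eq[of UNIV h]]) (auto simp: J_def)
  have "\<exists>a\<in>space M. 2 / 3 * real (card (J \<times> (UNIV :: bool set))) \<le> (\<Sum>j\<in>J \<times> UNIV. pr a j)"
    unfolding pr_def case_prod_beta
    by (rule pmf_averaging)
      (use M finJ d in \<open>auto simp: nonadaptive_alg_def approximates_lis_length_def C_def finite_set_arrays\<close>)
  then obtain a where a: "a \<in> space M"
    and avg: "2 / 3 * real (card (J \<times> (UNIV :: bool set))) \<le> (\<Sum>j\<in>J \<times> UNIV. pr a j)"
    by blast
  define Q where "Q = (\<lambda>p. (p - 1) div W) ` (set (queries a) \<inter> {1..K * W})"
  have "card Q \<le> card (set (queries a) \<inter> {1..K * W})"
    unfolding Q_def by (rule card_image_le) simp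
  also have "\<dots> \<le> card (set (queries a))"
    by (rule card_mono) auto
  also have "\<dots> \<le> length (queries a)"
    by (rule card_length)
  also have "\<dots> \<le> q"
    using M(1) a by (auto simp: nonadaptive_alg_def)
  finally have Q: "card Q \<le> q" .
  define B where "B = {w \<in> J. captured (d ^ 3) w Q}"
  have "card B \<le> card {w. length w = h \<and> captured (d ^ 3) w Q}"
    by (rule card_mono[OF finite_subset[OF _ finite_lists_length_eq[of UNIV h]]])
      (auto simp: B_def J_def)
  also have "\<dots> \<le> (card Q)\<^sup>2"
    by (rule card_captured_le) (simp add: Q_def)
  also have "\<dots> \<le> q\<^sup>2"
    using Q by (rule power_mono) simp
  finally have B: "card B \<le> q\<^sup>2" .
  have "pr a (w, True) + pr a (w, False) \<le> 1 + (if w \<in> B then 1 else 0)" if "w \<in> J" for w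
  proof (cases "w \<in> B")
    case True
    have "pr a (w, b) \<le> 1" for b
      by (simp add: pr_def)
    from this[of True] this[of False] True show ?thesis
      by simp
  next
    case False
    have "True \<in> set w"
      using that \<open>t > 0\<close> count_list_0_iff[of w True] by (auto simp: J_def)
    then show ?thesis
      using uncaptured_confuses[OF d, of w n W R a \<epsilon>] False that n gap
      by (auto simp: B_def J_def pr_def C_def K_def Q_def)
  qed
  then have "(\<Sum>w\<in>J. pr a (w, True) + pr a (w, False)) \<le> (\<Sum>w\<in>J. 1 + (if w \<in> B then 1 else 0))"
    by (rule sum_mono)
  also have "\<dots> = real (card J) + real (card B)"
    using finJ by (simp add: sum.distrib sum.If_cases B_def Int_def)
  also have "(\<Sum>w\<in>J. pr a (w, True) + pr a (w, False)) = (\<Sum>j\<in>J \<times> UNIV. pr a j)"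
    using sum.cartesian_product[of "\<lambda>w b. pr a (w, b)" UNIV J] by (simp add: UNIV_bool add.commute)
  finally have "4 / 3 * real (card J) \<le> real (card J) + real (card B)"
    using avg by (simp add: card_cartesian_product)
  then have "real (card J) \<le> real (3 * q\<^sup>2)"
    using B by linarith
  then show ?thesis
    by (simp add: J_def card_words del: of_nat_mult of_nat_power)
qed

subsection \<open>Choice of parameters\<close>

lemma exists_large_arity:
  assumes "(y :: real) < 1 / 4 ^ t"
  shows "\<exists>d. even d \<and> d > 0 \<and> y < lower d (Suc t) True - upper d (Suc t) False"
proof -
  have "(\<lambda>d. ((1 - 1 / real d) - (1 - (1 - 2 / real d) / 2 ^ t)) / 2 ^ t) \<longlonglongrightarrow>
      ((1 - 0) - (1 - (1 - 0) / 2 ^ t)) / 2 ^ t"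
    by (intro tendsto_intros lim_const_over_n) auto
  moreover have "((1 - 0) - (1 - (1 - 0) / 2 ^ t)) / 2 ^ t = (1 :: real) / 4 ^ t"
    by (simp flip: power_mult_distrib)
  ultimately have "(\<lambda>d. ((1 - 1 / real d) - (1 - (1 - 2 / real d) / 2 ^ t)) / 2 ^ t) \<longlonglongrightarrow> 1 / 4 ^ t"
    by (simp only:)
  from order_tendstoD(1)[OF this assms]
  have "\<forall>\<^sub>F d in sequentially. y < ((1 - 1 / real d) - (1 - (1 - 2 / real d) / 2 ^ t)) / 2 ^ t" .
  then obtain N where N: "\<And>d. d \<ge> N \<Longrightarrow> y < ((1 - 1 / real d) - (1 - (1 - 2 / real d) / 2 ^ t)) / 2 ^ t"
    by (auto simp: eventually_sequentially)
  show ?thesis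
    using N[of "2 * Suc N"] by (intro exI[of _ "2 * Suc N"]) (simp add: diff_divide_distrib)
qed

lemma depth_for_accuracy:
  assumes "0 < \<epsilon>" "\<epsilon> < 1 / 2"
  shows "\<exists>t. 2 * \<epsilon> < 1 / 4 ^ t \<and> log 2 (1 / \<epsilon>) / 5 \<le> real (Suc t)"
proof -
  define x where "x = log 2 (1 / \<epsilon>)"
  have "2 < 1 / \<epsilon>"
    using assms by (simp add: field_simps)
  then have x: "x > 1" "2 powr x = 1 / \<epsilon>"
    using assms by (auto simp: x_def less_log_iff)
  define t where "t = nat \<lfloor>(x - 1) / 4\<rfloor>"
  have "real t = of_int \<lfloor>(x - 1) / 4\<rfloor>"
    using x(1) by (simp add: t_def)
  then have t: "real t \<le> (x - 1) / 4" "(x - 1) / 4 < real t + 1"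
    using floor_correct[of "(x - 1) / 4"] by simp_all
  have "(4 :: real) ^ t = 2 powr (2 * real t)"
    by (simp add: powr_realpow powr_powr[symmetric])
  also have "\<dots> < 2 powr (x - 1)"
    using t(1) x(1) by (intro powr_less_mono) auto
  also have "\<dots> = 1 / (2 * \<epsilon>)"
    by (simp add: powr_diff x(2))
  finally have "2 * \<epsilon> < 1 / 4 ^ t"
    using assms(1) by (simp add: field_simps)
  moreover have "x / 5 \<le> real (Suc t)"
    using t(2) by (cases "x \<ge> 5") (auto simp: field_simps)
  ultimately show ?thesis
    unfolding x_def by blast
qed

lemma exists_height:
  assumes "(k :: nat) > 1" "n > 0"
  shows "\<exists>h. real (k ^ h) \<le> sqrt (real n) \<and> log 2 (real n) / (2 * log 2 (real k)) - 1 \<le> real h"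
proof -
  define h where "h = nat \<lfloor>log k (real n) / 2\<rfloor>"
  have "log k (real n) \<ge> 0"
    using assms by simp
  then have h: "real h \<le> log k (real n) / 2" "log k (real n) / 2 - 1 \<le> real h"
    by (auto simp: h_def) linarith
  have "real (k ^ h) = real k powr real h"
    using assms by (simp add: powr_realpow)
  also have "\<dots> \<le> real k powr (log k (real n) / 2)"
    using h(1) assms by (intro powr_mono) auto
  also have "\<dots> = sqrt (real k powr log k (real n))"
    by (simp add: powr_half_sqrt[symmetric] powr_powr)
  also have "\<dots> = sqrt (real n)"
    using assms by simp
  finally have "real (k ^ h) \<le> sqrt (real n)" .
  moreover have "log k (real n) / 2 = log 2 (real n) / (2 * log 2 (real k))"
    using assms by (subst log_base_change[of 2]) auto
  ultimately show ?thesis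
    using h(2) by auto
qed

theorem theorem1p1:
  "\<exists>c::real. c > 0 \<and>
     (\<forall>\<epsilon>::real. 0 < \<epsilon> \<and> \<epsilon> < 1 / 2 \<longrightarrow>
       (\<forall>\<^sub>F n in sequentially.
         \<forall>(q::nat) (M :: det_nonadaptive measure).
           nonadaptive_alg n q M \<and> approximates_lis_length \<epsilon> n M \<longrightarrow>
           log 2 (real n) powr (c * log 2 (1 / \<epsilon>)) \<le> real q))"
proof (intro exI[of _ "1 / 20"] conjI allI impI)
  fix \<epsilon> :: real
  assume "0 < \<epsilon> \<and> \<epsilon> < 1 / 2"
  then have \<epsilon>: "0 < \<epsilon>" "\<epsilon> < 1 / 2"
    by auto
  obtain s where s: "2 * \<epsilon> < 1 / 4 ^ s" "log 2 (1 / \<epsilon>) / 5 \<le> real (Suc s)"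
    using depth_for_accuracy[OF \<epsilon>] by blast
  define t where "t = Suc s"
  obtain d where d: "even d" "d > 0" and gap: "2 * \<epsilon> < lower d t True - upper d t False"
    using exists_large_arity[OF s(1)] unfolding t_def by blast
  define \<delta> where "\<delta> = lower d t True - upper d t False - 2 * \<epsilon>"
  define \<alpha> where "\<alpha> = 1 / (2 * log 2 (real (d ^ 3)))"
  have "d \<ge> 2"
    using d by presburger
  then have k: "d ^ 3 > 1"
    by (intro one_less_power) auto
  then have "log 2 (real (d ^ 3)) > 0"
    by (subst zero_less_log_cancel_iff) (use \<open>d \<ge> 2\<close> in \<open>auto intro: one_less_power\<close>)
  then have "\<alpha> > 0"
    by (simp add: \<alpha>_def del: of_nat_power)
  have "\<delta> > 0"
    using gap by (simp add: \<delta>_def)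
  have "lower d t True \<le> 1"
  proof -
    have "(1 - 1 / real d) / 2 ^ s \<le> 1 / 1"
      by (intro frac_le) auto
    then show ?thesis by (simp add: t_def)
  qed
  then have diff_le: "lower d t True - upper d t False \<le> 1"
    using upper_nonneg[of d t False] by linarith
  have T: "real t > 0"
    by (simp add: t_def)
  have "\<forall>\<^sub>F n in sequentially. 2 * sqrt (real n) < \<delta> * real n"
    using \<open>\<delta> > 0\<close> by real_asymp
  moreover have "\<forall>\<^sub>F n in sequentially. 3 * sqrt (log 2 (real n)) < (\<alpha> * log 2 (real n) - 1) / real t"
    using \<open>\<alpha> > 0\<close> T by real_asymp
  moreover have "\<forall>\<^sub>F n in sequentially. 1 \<le> log 2 (real n)" "\<forall>\<^sub>F n in sequentially. real t \<le> \<alpha> * log 2 (real n) - 1"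
    using \<open>\<alpha> > 0\<close> by real_asymp+
  moreover have "\<forall>\<^sub>F n in sequentially. n > (0 :: nat)"
    by (rule eventually_gt_at_top)
  ultimately show "\<forall>\<^sub>F n in sequentially. \<forall>(q::nat) (M :: det_nonadaptive measure).
           nonadaptive_alg n q M \<and> approximates_lis_length \<epsilon> n M \<longrightarrow>
           log 2 (real n) powr (1 / 20 * log 2 (1 / \<epsilon>)) \<le> real q"
  proof (eventually_elim, intro allI impI, elim conjE)
    fix n q :: nat and M :: "det_nonadaptive measure"
    define L where "L = log 2 (real n)"
    assume n: "2 * sqrt (real n) < \<delta> * real n" "3 * sqrt (log 2 (real n)) < (\<alpha> * log 2 (real n) - 1) / real t"
        "1 \<le> log 2 (real n)" "real t \<le> \<alpha> * log 2 (real n) - 1" "n > 0"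
      and M: "nonadaptive_alg n q M" "approximates_lis_length \<epsilon> n M"
    note L = n(2-4)[folded L_def]
    obtain h where h: "real ((d ^ 3) ^ h) \<le> sqrt (real n)" "\<alpha> * L - 1 \<le> real h"
      using exists_height[OF k n(5)] by (auto simp: \<alpha>_def L_def simp del: of_nat_power)
    define K where "K = (d ^ 3) ^ h"
    define W R where "W = n div K" and "R = n mod K"
    have nKW: "n = K * W + R"
      by (simp add: W_def R_def)
    have "K > 0"
      using d by (simp add: K_def)
    then have "R < K"
      by (simp add: R_def)
    then have "real R \<le> sqrt (real n)"
      using h(1) by (simp add: K_def del: of_nat_power)
    have "real (K * W) * (lower d t True - upper d t False) =
        real n * (lower d t True - upper d t False) - real R * (lower d t True - upper d t False)"
      by (simp add: nKW algebra_simps)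
    moreover have "real R * (lower d t True - upper d t False) \<le> real R * 1"
      using diff_le by (intro mult_left_mono) auto
    moreover have "real n * (lower d t True - upper d t False) = real n * \<delta> + 2 * \<epsilon> * real n"
      by (simp add: \<delta>_def algebra_simps)
    ultimately have "real (K * W) * upper d t False + real R + 2 * \<epsilon> * real n < real (K * W) * lower d t True"
      using n(1) \<open>real R \<le> sqrt (real n)\<close> by (simp add: algebra_simps)
    then have "h choose t \<le> 3 * q\<^sup>2"
      using nKW by (intro query_bound[OF M d]) (auto simp: K_def t_def)
    then have "real (h choose t) \<le> real (3 * q\<^sup>2)"
      by linarith
    moreover have "t \<le> h"
      using L(3) h(2) by linarith
    then have "(real h / real t) ^ t \<le> real (h choose t)"
      by (rule binomial_ge_n_over_k_pow_k)
    moreover have "3 * L powr (real t / 2) \<le> (real h / real t) ^ t"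
    proof -
      have "3 * sqrt L \<le> (\<alpha> * L - 1) / real t"
        using L(1) by simp
      also have "\<dots> \<le> real h / real t"
        using h(2) by (intro divide_right_mono) auto
      finally have "(3 * sqrt L) ^ t \<le> (real h / real t) ^ t"
        using L(2) by (intro power_mono) auto
      moreover have "sqrt L ^ t = (L powr (1 / 2)) powr real t"
        using L(2) by (subst powr_realpow) (auto simp: powr_half_sqrt)
      then have "(3 * sqrt L) ^ t = 3 ^ t * L powr (real t / 2)"
        by (simp add: power_mult_distrib powr_powr)
      moreover have "3 * L powr (real t / 2) \<le> 3 ^ t * L powr (real t / 2)"
        using self_le_power[of "3 :: real" t] by (intro mult_right_mono) (auto simp: t_def)
      ultimately show ?thesis
        by linarith
    qed
    ultimately have "L powr (real t / 2) \<le> (real q)\<^sup>2"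
      by simp
    moreover have "L powr (real t / 2) = (L powr (real t / 4))\<^sup>2"
      by (simp add: power2_eq_square flip: powr_add)
    ultimately have "(L powr (real t / 4))\<^sup>2 \<le> (real q)\<^sup>2"
      by simp
    then have "L powr (real t / 4) \<le> real q"
      by (rule power2_le_imp_le) simp
    moreover have "L powr (1 / 20 * log 2 (1 / \<epsilon>)) \<le> L powr (real t / 4)"
      using L(2) s(2) by (intro powr_mono) (auto simp: t_def)
    ultimately show "log 2 (real n) powr (1 / 20 * log 2 (1 / \<epsilon>)) \<le> real q"
      by (simp add: L_def)
  qed
qed simp

end
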